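(* Let $\beta>0$. For every $\alpha\in\aleph$, the generalized Laguerre functions $l^{\alpha,\beta}_k$, $k\ge\chi(\alpha)$, are mutually orthogonal with respect to the weight $w^{\alpha}$: $$a^{\alpha,\beta}_0(l^{\alpha,\beta}_k,l^{\alpha,\beta}_m)=(l^{\alpha,\beta}_k,l^{\alpha,\beta}_m)_{w^{\alpha}}=\beta^{-\alpha-1}\gamma^{\alpha}_k\,\delta_{k,m},\qquad k,m\ge\chi(\alpha).$$ More generally, for every $n\in\mathbb{N}_0$ and $\alpha\in\mathbb{R}$ with $\alpha+n\in\aleph$, $$a^{\alpha,\beta}_n(l^{\alpha,\beta}_k,l^{\alpha,\beta}_m)=\beta^{n-\alpha-1}\gamma^{\alpha}_{k,n}\,\delta_{k,m},\qquad k,m\ge\chi_n(\alpha),$$ where the positive numbers $\gamma^{\alpha}_{k,n}$ satisfy the recurrence relation $$\gamma^{\alpha+n}_{k,0}=\gamma^{\alpha+n}_k,\qquad \gamma^{\alpha}_{k,n}=\tfrac12\big[\gamma^{\alpha+1}_{k,n-1}+\gamma^{\alpha+1}_{k-1,n-1}\big],\quad n\ge1,$$ under the convention that $\gamma^{\alpha}_{k,n}=0$ whenever $k$ is a negative integer.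
   Context: $\mathbb{N}_0$ and $\mathbb{Z}^-$ denote the nonnegative and the negative integers; $\aleph=\mathbb{Z}^-\cup(-1,+\infty)$; $\Lambda=(0,\infty)$; $w^{\alpha}(x)=x^{\alpha}$; $(u,v)_{w^{\alpha}}=\int_{\Lambda}u(x)v(x)x^{\alpha}\,dx$; $\delta_{k,m}$ is the Kronecker symbol. For $n\in\mathbb{N}_0$ set $\chi_n(\alpha)=-\alpha$ if $\alpha+n\in\mathbb{Z}^-$ and $\chi_n(\alpha)=0$ if $\alpha+n\in(-1,+\infty)$; write $\chi=\chi_0$. For $a\in\mathbb{R}$ let $(a)_n=a(a+1)\cdots(a+n-1)$, $(a)_0=1$. For any $\alpha\in\mathbb{R}$ the generalized Laguerre polynomials are $\mathcal{L}^{\alpha}_k(x)=\sum_{\nu=0}^{k}\frac{(\alpha+\nu+1)_{k-\nu}}{(k-\nu)!\,\nu!}(-x)^{\nu}$, $k\ge0$, and for $\beta>0$ the generalized Laguerre functions are $l^{\alpha,\beta}_k(x)=e^{-\frac12\beta x}\mathcal{L}^{\alpha}_k(\beta x)$. Set $\gamma^{\alpha}_k=\dfrac{\Gamma(k+\alpha+1)}{k!}$ (for $\alpha\in\aleph$, $k\ge\chi(\alpha)$), and define the bilinear form $$a^{\alpha,\beta}_n(u,v)=\sum_{\nu=0}^{n}\binom{n}{\nu}\frac{\beta^{2n-2\nu}}{2^{2n-2\nu}}(\partial_x^{\nu}u,\partial_x^{\nu}v)_{w^{\alpha+n}}.$$ *)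

theory Defs
  imports "HOL-Analysis.Analysis"
begin

definition neg_integers :: "real set" where
  "neg_integers = real_of_int ` {z. z < 0}"

definition aleph :: "real set" where
  "aleph = neg_integers \<union> {-1<..}"

text \<open>Only meant for \<open>\<alpha> + n \<in> aleph\<close>.\<close>
definition chi :: "nat \<Rightarrow> real \<Rightarrow> real" where
  "chi n \<alpha> = (if \<alpha> + real n \<in> neg_integers then - \<alpha> else 0)"

definition weighted_integrable :: "real \<Rightarrow> (real \<Rightarrow> real) \<Rightarrow> (real \<Rightarrow> real) \<Rightarrow> bool" where
  "weighted_integrable \<alpha> u v \<longleftrightarrow>
     set_integrable lborel {0<..} (\<lambda>x. u x * v x * x powr \<alpha>)"

definition weighted_inner :: "real \<Rightarrow> (real \<Rightarrow> real) \<Rightarrow> (real \<Rightarrow> real) \<Rightarrow> real" where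
  "weighted_inner \<alpha> u v = (LINT x:{0<..}|lborel. u x * v x * x powr \<alpha>)"

definition laguerre_poly :: "real \<Rightarrow> nat \<Rightarrow> real \<Rightarrow> real" where
  "laguerre_poly \<alpha> k x =
     (\<Sum>\<nu>\<le>k. pochhammer (\<alpha> + real \<nu> + 1) (k - \<nu>) / (fact (k - \<nu>) * fact \<nu>) * (- x) ^ \<nu>)"

definition laguerre_fun :: "real \<Rightarrow> real \<Rightarrow> nat \<Rightarrow> real \<Rightarrow> real" where
  "laguerre_fun \<alpha> \<beta> k x = exp (- (\<beta> * x / 2)) * laguerre_poly \<alpha> k (\<beta> * x)"

definition laguerre_gamma :: "real \<Rightarrow> nat \<Rightarrow> real" where
  "laguerre_gamma \<alpha> k = Gamma (real k + \<alpha> + 1) / fact k"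

text \<open>\<open>laguerre_gamma_rec n \<alpha> k\<close> is $\gamma^{\alpha}_{k,n}$. The index \<open>k\<close> is an integer so that
  \<open>k - 1\<close> may be negative; the convention that the value is then \<open>0\<close> is imposed for \<open>n = 0\<close>
  and passes to all \<open>n\<close> through the recurrence.\<close>
primrec laguerre_gamma_rec :: "nat \<Rightarrow> real \<Rightarrow> int \<Rightarrow> real" where
  "laguerre_gamma_rec 0 \<alpha> k = (if k < 0 then 0 else laguerre_gamma \<alpha> (nat k))"
| "laguerre_gamma_rec (Suc n) \<alpha> k =
     1 / 2 * (laguerre_gamma_rec n (\<alpha> + 1) k + laguerre_gamma_rec n (\<alpha> + 1) (k - 1))"

definition laguerre_form ::
    "real \<Rightarrow> real \<Rightarrow> nat \<Rightarrow> (real \<Rightarrow> real) \<Rightarrow> (real \<Rightarrow> real) \<Rightarrow> real" where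
  "laguerre_form \<alpha> \<beta> n u v =
     (\<Sum>\<nu>\<le>n. real (n choose \<nu>) * (\<beta> ^ (2 * n - 2 * \<nu>) / 2 ^ (2 * n - 2 * \<nu>)) *
        weighted_inner (\<alpha> + real n) ((deriv ^^ \<nu>) u) ((deriv ^^ \<nu>) v))"

definition kronecker :: "nat \<Rightarrow> nat \<Rightarrow> real" where
  "kronecker k m = (if k = m then 1 else 0)"

end

theory Submission
  imports Defs "HOL-Computational_Algebra.Polynomial"
begin

text \<open>
  Contiguity relations and Pascal's rule reduce the family of forms to a single integral. Write
  \<open>L\<^sup>\<alpha>\<^sub>k\<close> for the Laguerre polynomial, set to \<open>0\<close> for \<open>k < 0\<close>, and \<open>l\<^sup>\<alpha>\<^sub>k\<close> for the
  corresponding function. Then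
  \<^item> \<open>l\<^sup>\<alpha>\<^sub>k = u - u'\<close> and \<open>\<partial>l\<^sup>\<alpha>\<^sub>k = - (\<beta>/2) (u + u')\<close>, where \<open>u\<close> and \<open>u'\<close> are the Laguerre functions
    with parameter \<open>\<alpha> + 1\<close> and indices \<open>k\<close> and \<open>k - 1\<close>;
  \<^item> by Pascal's rule, the form with parameters \<open>\<alpha>, n + 1\<close> at \<open>(f, g)\<close> is \<open>\<beta>\<^sup>2/4\<close> times the form with
    parameters \<open>\<alpha> + 1, n\<close> at \<open>(f, g)\<close>, plus the latter at \<open>(\<partial>f, \<partial>g)\<close>. The weight
    exponent \<open>\<alpha> + n + 1\<close> is the same on both sides.
  Inserting the first fact into the second leaves a sum of the form evaluated at differences and at
  sums. By the parallelogram identity the mixed terms cancel, and what remains is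
  \<open>\<beta>\<^sup>2/2\<close> times the values at \<open>(k, m)\<close> and at \<open>(k - 1, m - 1)\<close>. This is the recurrence of the
  \<open>\<gamma>\<close> numbers, with the Kronecker symbol (\<open>sobolev_form_laguerre\<close>).

  The induction starts from orthogonality for the weight \<open>x\<^sup>\<alpha>\<close> alone
  (\<open>laguerre_orthogonal\<close>). For \<open>\<alpha> > -1\<close> the moments of \<open>L\<^sup>\<alpha>\<^sub>k\<close> are Gamma values, and pairing
  \<open>L\<^sup>\<alpha>\<^sub>k\<close> with \<open>x\<^sup>m\<close> gives a \<open>k\<close>-th finite difference of a polynomial of degree \<open>m\<close>,
  so it vanishes for \<open>m < k\<close>. For \<open>\<alpha> = -p\<close> a negative integer and \<open>k \<ge> p\<close>, the polynomial
  is a multiple of \<open>x\<^sup>p\<close> times the Laguerre polynomial with parameter \<open>p\<close> and index \<open>k - p\<close>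
  (\<open>laguerre_reflection\<close>); the two factors \<open>x\<^sup>p\<close> turn the singular weight \<open>x\<close> to the
  power \<open>-p\<close> into \<open>x\<^sup>p\<close>, which is the classical case again.

  Derivatives never have to be computed analytically beyond one step: on functions
  \<open>exp (- \<beta> x / 2) p (\<beta> x)\<close> differentiation is the operator \<open>p \<mapsto> p' - p / 2\<close> on polynomials, up to
  a factor \<open>\<beta>\<close>. Rescaling \<open>x\<close> then extracts every power of \<open>\<beta>\<close>, so all of the above takes place
  among polynomials with one linear functional. Integrability reduces to divisibility: for a weight
  exponent \<open>-m\<close> it is enough that both polynomials are divisible by \<open>x\<^sup>m\<close> (\<open>tame\<close>).
\<close>

section \<open>Exponential polynomials and the Laguerre functional\<close>

definition exp_poly :: "real \<Rightarrow> real poly \<Rightarrow> real \<Rightarrow> real" where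
  "exp_poly \<beta> p x = exp (- (\<beta> * x / 2)) * poly p (\<beta> * x)"

text \<open>Differentiation, seen on the polynomial factor of an \<open>exp_poly\<close> with \<open>\<beta> = 1\<close>.\<close>
definition laguerre_deriv :: "real poly \<Rightarrow> real poly" where
  "laguerre_deriv p = pderiv p - smult (1 / 2) p"

lemma laguerre_deriv_linear:
  "laguerre_deriv (p + q) = laguerre_deriv p + laguerre_deriv q"
  "laguerre_deriv (p - q) = laguerre_deriv p - laguerre_deriv q"
  "laguerre_deriv (smult c p) = smult c (laguerre_deriv p)"
  by (simp_all add: laguerre_deriv_def pderiv_add pderiv_diff pderiv_smult smult_add_right
      smult_diff_right)

lemma laguerre_deriv_pow_linear:
  "(laguerre_deriv ^^ n) (p + q) = (laguerre_deriv ^^ n) p + (laguerre_deriv ^^ n) q"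
  "(laguerre_deriv ^^ n) (p - q) = (laguerre_deriv ^^ n) p - (laguerre_deriv ^^ n) q"
  "(laguerre_deriv ^^ n) (smult c p) = smult c ((laguerre_deriv ^^ n) p)"
  by (induction n) (simp_all add: laguerre_deriv_linear)

lemma deriv_exp_poly: "deriv (exp_poly \<beta> p) = exp_poly \<beta> (smult \<beta> (laguerre_deriv p))"
proof
  fix x
  have "(exp_poly \<beta> p has_real_derivative exp_poly \<beta> (smult \<beta> (laguerre_deriv p)) x) (at x)"
    unfolding exp_poly_def[abs_def] laguerre_deriv_def
    by (auto intro!: derivative_eq_intros DERIV_chain2[OF poly_DERIV]
        simp: algebra_simps)
  then show "deriv (exp_poly \<beta> p) x = exp_poly \<beta> (smult \<beta> (laguerre_deriv p)) x"
    by (rule DERIV_imp_deriv)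
qed

lemma deriv_pow_exp_poly:
  "(deriv ^^ n) (exp_poly \<beta> p) = exp_poly \<beta> (smult (\<beta> ^ n) ((laguerre_deriv ^^ n) p))"
  by (induction n) (simp_all add: deriv_exp_poly laguerre_deriv_linear mult.commute)

text \<open>The exponential carries \<open>- x\<close> rather than \<open>- x / 2\<close> because the functional is applied to the
  product of the polynomial factors of two \<open>exp_poly\<close>s.\<close>
definition laguerre_integrable :: "real \<Rightarrow> real poly \<Rightarrow> bool" where
  "laguerre_integrable \<gamma> p \<longleftrightarrow>
     set_integrable lborel {0<..} (\<lambda>x. exp (- x) * poly p x * x powr \<gamma>)"

definition laguerre_functional :: "real \<Rightarrow> real poly \<Rightarrow> real" where
  "laguerre_functional \<gamma> p = (LINT x:{0<..}|lborel. exp (- x) * poly p x * x powr \<gamma>)"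

text \<open>The substitution \<open>x \<mapsto> \<beta> x\<close>. The summand \<open>0\<close> gives the right-hand side the shape of an affine
  change of variables on the real line.\<close>
lemma exp_poly_product_scaling:
  assumes "\<beta> > 0"
  shows "indicator {0<..} x *\<^sub>R (exp_poly \<beta> p x * exp_poly \<beta> q x * x powr \<gamma>) =
    \<beta> powr (- \<gamma>) *
      (indicator {0<..} (0 + \<beta> * x) *\<^sub>R
        (exp (- (0 + \<beta> * x)) * poly (p * q) (0 + \<beta> * x) * (0 + \<beta> * x) powr \<gamma>))"
proof (cases "x > 0")
  case True
  have "exp (- (\<beta> * x)) = exp (- (\<beta> * x / 2)) * exp (- (\<beta> * x / 2))"
    by (simp flip: exp_add)
  moreover have "\<beta> powr (- \<gamma>) * (\<beta> * x) powr \<gamma> = x powr \<gamma>"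
    using True assms by (simp add: powr_mult powr_minus field_simps)
  ultimately show ?thesis
    using True assms by (simp add: exp_poly_def mult_ac)
next
  case False
  with assms show ?thesis
    by (simp add: indicator_def zero_less_mult_iff)
qed

lemma weighted_integrable_exp_poly:
  assumes "\<beta> > 0"
  shows "weighted_integrable \<gamma> (exp_poly \<beta> p) (exp_poly \<beta> q) \<longleftrightarrow>
    laguerre_integrable \<gamma> (p * q)"
proof -
  let ?f = "\<lambda>x. indicator {0<..} x *\<^sub>R (exp (- x) * poly (p * q) x * x powr \<gamma>)"
  have "weighted_integrable \<gamma> (exp_poly \<beta> p) (exp_poly \<beta> q) \<longleftrightarrow>
      integrable lborel (\<lambda>x. \<beta> powr (- \<gamma>) * ?f (0 + \<beta> * x))"
    unfolding weighted_integrable_def set_integrable_def exp_poly_product_scaling[OF assms] ..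
  also have "\<dots> \<longleftrightarrow> integrable lborel (\<lambda>x. ?f (0 + \<beta> * x))"
    using assms by (subst integrable_mult_left_iff) simp
  also have "\<dots> \<longleftrightarrow> integrable lborel ?f"
    using assms by (intro lborel_integrable_real_affine_iff) simp
  finally show ?thesis
    unfolding laguerre_integrable_def set_integrable_def .
qed

lemma weighted_inner_exp_poly:
  assumes "\<beta> > 0"
  shows "weighted_inner \<gamma> (exp_poly \<beta> p) (exp_poly \<beta> q) =
    \<beta> powr (- \<gamma> - 1) * laguerre_functional \<gamma> (p * q)"
proof -
  let ?f = "\<lambda>x. indicator {0<..} x *\<^sub>R (exp (- x) * poly (p * q) x * x powr \<gamma>)"
  have "weighted_inner \<gamma> (exp_poly \<beta> p) (exp_poly \<beta> q) =
      \<beta> powr (- \<gamma>) * (LINT x|lborel. ?f (0 + \<beta> * x))"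
    unfolding weighted_inner_def set_lebesgue_integral_def exp_poly_product_scaling[OF assms]
    by (rule integral_mult_right_zero)
  also have "(LINT x|lborel. ?f (0 + \<beta> * x)) = (LINT x|lborel. ?f x) / \<beta>"
    using lborel_integral_real_affine[of \<beta> ?f 0] assms by simp
  also have "\<beta> powr (- \<gamma>) * ((LINT x|lborel. ?f x) / \<beta>) =
      \<beta> powr (- \<gamma> - 1) * laguerre_functional \<gamma> (p * q)"
    using assms by (simp add: powr_diff laguerre_functional_def set_lebesgue_integral_def)
  finally show ?thesis .
qed

lemma laguerre_integrable_add:
  "laguerre_integrable \<gamma> p \<Longrightarrow> laguerre_integrable \<gamma> q \<Longrightarrow> laguerre_integrable \<gamma> (p + q)"
  unfolding laguerre_integrable_def
  by (drule (1) set_integral_add(1)) (simp add: algebra_simps)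

lemma laguerre_functional_add:
  "laguerre_integrable \<gamma> p \<Longrightarrow> laguerre_integrable \<gamma> q \<Longrightarrow>
   laguerre_functional \<gamma> (p + q) = laguerre_functional \<gamma> p + laguerre_functional \<gamma> q"
  unfolding laguerre_integrable_def laguerre_functional_def
  by (drule (1) set_integral_add(2)) (simp add: algebra_simps)

lemma laguerre_integrable_smult:
  "laguerre_integrable \<gamma> p \<Longrightarrow> laguerre_integrable \<gamma> (smult c p)"
  unfolding laguerre_integrable_def
  using set_integrable_mult_right[of c lborel "{0<..}"] by (auto simp: mult_ac)

lemma laguerre_functional_smult:
  "laguerre_functional \<gamma> (smult c p) = c * laguerre_functional \<gamma> p"
  unfolding laguerre_functional_def
  by (subst set_integral_mult_right[symmetric]) (simp add: mult_ac)

lemma laguerre_functional_0 [simp]: "laguerre_functional \<gamma> 0 = 0"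
  by (simp add: laguerre_functional_def)

lemma laguerre_integrable_0 [simp]: "laguerre_integrable \<gamma> 0"
  by (simp add: laguerre_integrable_def set_integrable_def)

lemma
  assumes "finite A" "\<And>i. i \<in> A \<Longrightarrow> laguerre_integrable \<gamma> (f i)"
  shows laguerre_integrable_sum: "laguerre_integrable \<gamma> (sum f A)"
    and laguerre_functional_sum:
      "laguerre_functional \<gamma> (sum f A) = (\<Sum>i\<in>A. laguerre_functional \<gamma> (f i))"
proof -
  have "laguerre_integrable \<gamma> (sum f A) \<and>
      laguerre_functional \<gamma> (sum f A) = (\<Sum>i\<in>A. laguerre_functional \<gamma> (f i))"
    using assms
    by (induction A rule: finite_induct)
      (simp_all add: laguerre_integrable_add laguerre_functional_add)
  then show "laguerre_integrable \<gamma> (sum f A)"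
    "laguerre_functional \<gamma> (sum f A) = (\<Sum>i\<in>A. laguerre_functional \<gamma> (f i))"
    by auto
qed

lemma Gamma_has_bochner_integral:
  fixes s :: real
  assumes "s > -1"
  shows "has_bochner_integral lborel
    (\<lambda>x. indicator {0<..} x *\<^sub>R (exp (- x) * x powr s)) (Gamma (s + 1))"
proof (rule has_bochner_integral_nn_integral)
  have "ennreal (indicator {0<..} x *\<^sub>R (exp (- x) * x powr s)) =
      ennreal (indicator {0..} x * x powr (s + 1 - 1) / exp x)" for x
    by (auto simp: indicator_def exp_minus field_simps)
  then show "(\<integral>\<^sup>+ x. ennreal (indicator {0<..} x *\<^sub>R (exp (- x) * x powr s)) \<partial>lborel) =
      ennreal (Gamma (s + 1))"
    using Gamma_conv_nn_integral_real[of "s + 1"] assms by simp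
qed (use assms in \<open>auto intro!: Gamma_real_nonneg\<close>)

lemma
  assumes "\<gamma> > -1"
  shows laguerre_integrable_monom: "laguerre_integrable \<gamma> (monom c i)"
    and laguerre_functional_monom:
      "laguerre_functional \<gamma> (monom c i) = c * Gamma (\<gamma> + real i + 1)"
proof -
  have eq: "indicator {0<..} x *\<^sub>R (exp (- x) * poly (monom c i) x * x powr \<gamma>) =
      c * (indicator {0<..} x *\<^sub>R (exp (- x) * x powr (\<gamma> + real i)))" for x
    by (simp add: indicator_def poly_monom powr_add powr_realpow)
  have *: "has_bochner_integral lborel
      (\<lambda>x. c * (indicator {0<..} x *\<^sub>R (exp (- x) * x powr (\<gamma> + real i))))
      (c * Gamma (\<gamma> + real i + 1))"
    using assms by (intro has_bochner_integral_mult_right Gamma_has_bochner_integral) auto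
  show "laguerre_integrable \<gamma> (monom c i)"
    using * unfolding laguerre_integrable_def set_integrable_def eq
    by (simp add: has_bochner_integral_iff)
  show "laguerre_functional \<gamma> (monom c i) = c * Gamma (\<gamma> + real i + 1)"
    using * unfolding laguerre_functional_def set_lebesgue_integral_def eq
    by (rule has_bochner_integral_integral_eq)
qed

lemma laguerre_integrable_poly:
  assumes "\<gamma> > -1"
  shows "laguerre_integrable \<gamma> p"
  by (subst poly_as_sum_of_monoms[symmetric])
    (intro laguerre_integrable_sum laguerre_integrable_monom assms finite_atMost)

text \<open>A space of polynomials on which the pairing \<open>(p, q) \<mapsto> laguerre_functional \<gamma> (p * q)\<close> is
  a genuine bilinear form. For \<open>\<gamma> \<le> -1\<close> the integral of the functional converges only for some
  polynomials, so expanding products under it requires a subspace whose products are all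
  integrable.\<close>
definition tame :: "real \<Rightarrow> real poly \<Rightarrow> bool" where
  "tame \<gamma> p \<longleftrightarrow> \<gamma> > -1 \<or> (\<exists>m. \<gamma> = - real m \<and> monom 1 m dvd p)"

lemma tame_add: "tame \<gamma> p \<Longrightarrow> tame \<gamma> q \<Longrightarrow> tame \<gamma> (p + q)"
  and tame_diff: "tame \<gamma> p \<Longrightarrow> tame \<gamma> q \<Longrightarrow> tame \<gamma> (p - q)"
  and tame_smult: "tame \<gamma> p \<Longrightarrow> tame \<gamma> (smult c p)"
  by (auto simp: tame_def dvd_smult)

lemma monom_weight:
  fixes x :: real
  assumes "x > 0"
  shows "exp (- x) * poly (monom 1 m * p * (monom 1 m * q)) x * x powr (- real m) =
    exp (- x) * poly (p * q) x * x powr real m"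
  using assms by (simp add: poly_monom powr_minus powr_realpow field_simps)

lemma laguerre_functional_monom_mult:
  "laguerre_functional (- real m) (monom 1 m * p * (monom 1 m * q)) =
   laguerre_functional (real m) (p * q)"
  unfolding laguerre_functional_def
  by (intro set_lebesgue_integral_cong) (auto simp only: monom_weight greaterThan_iff, auto)

text \<open>For \<open>\<gamma> = - m\<close> the product is divisible by \<open>x\<close> to the power \<open>2 m\<close>, which turns the weight
  exponent \<open>- m\<close> into \<open>m\<close>.\<close>
lemma tame_mult_integrable:
  assumes "tame \<gamma> p" "tame \<gamma> q"
  shows "laguerre_integrable \<gamma> (p * q)"
proof (cases "\<gamma> > -1")
  case True
  then show ?thesis by (rule laguerre_integrable_poly)
next
  case False
  with assms obtain m p' q' where \<gamma>: "\<gamma> = - real m"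
    and "p = monom 1 m * p'" "q = monom 1 m * q'"
    unfolding tame_def dvd_def by auto
  moreover have "laguerre_integrable (real m) (p' * q')"
    by (rule laguerre_integrable_poly) simp
  then have "laguerre_integrable (- real m) (monom 1 m * p' * (monom 1 m * q'))"
    unfolding laguerre_integrable_def
    by (subst set_integrable_cong[OF refl refl monom_weight]) auto
  ultimately show ?thesis by simp
qed

section \<open>Laguerre polynomials\<close>

text \<open>The index is an integer, and the polynomial is \<open>0\<close> for a negative one, so that the contiguity
  relations below hold at \<open>k = 0\<close> too.\<close>
definition laguerre_coeff :: "real \<Rightarrow> int \<Rightarrow> nat \<Rightarrow> real" where
  "laguerre_coeff \<alpha> k i = (if int i \<le> k then
     (-1) ^ i * pochhammer (\<alpha> + real i + 1) (nat k - i) / (fact (nat k - i) * fact i) else 0)"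

definition laguerre :: "real \<Rightarrow> int \<Rightarrow> real poly" where
  "laguerre \<alpha> k = (\<Sum>i\<le>nat k. monom (laguerre_coeff \<alpha> k i) i)"

lemma coeff_laguerre: "coeff (laguerre \<alpha> k) i = laguerre_coeff \<alpha> k i"
  by (auto simp: laguerre_def coeff_sum laguerre_coeff_def)

lemma laguerre_neg [simp]: "k < 0 \<Longrightarrow> laguerre \<alpha> k = 0"
  by (rule poly_eqI) (simp add: coeff_laguerre laguerre_coeff_def)

lemma laguerre_fun_eq_exp_poly: "laguerre_fun \<alpha> \<beta> k = exp_poly \<beta> (laguerre \<alpha> (int k))"
proof
  fix x
  have "laguerre_poly \<alpha> k y = poly (laguerre \<alpha> (int k)) y" for y
    unfolding laguerre_poly_def laguerre_def poly_sum nat_int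
  proof (intro sum.cong refl)
    fix i assume "i \<in> {..k}"
    then show "pochhammer (\<alpha> + real i + 1) (k - i) / (fact (k - i) * fact i) * (- y) ^ i =
        poly (monom (laguerre_coeff \<alpha> (int k) i) i) y"
      by (simp add: poly_monom laguerre_coeff_def power_minus[of y])
  qed
  then show "laguerre_fun \<alpha> \<beta> k x = exp_poly \<beta> (laguerre \<alpha> (int k)) x"
    by (simp add: laguerre_fun_def exp_poly_def)
qed

lemma pochhammer_contiguous:
  fixes a :: real
  shows "pochhammer a (Suc n) / fact (Suc n) =
    pochhammer (a + 1) (Suc n) / fact (Suc n) - pochhammer (a + 1) n / fact n"
proof -
  have "pochhammer (a + 1) (Suc n) / fact (Suc n) - pochhammer a (Suc n) / fact (Suc n) =
      (1 + real n) * pochhammer (a + 1) n / fact (Suc n)"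
    unfolding pochhammer_rec[of a] pochhammer_rec'[of "a + 1"]
    by (simp only: diff_divide_distrib[symmetric]) (simp add: algebra_simps)
  also have "\<dots> = pochhammer (a + 1) n / fact n"
    by simp
  finally show ?thesis by simp
qed

text \<open>Coefficientwise this is \<open>pochhammer_contiguous\<close>, a form of Pascal's rule.\<close>
lemma laguerre_contiguous: "laguerre \<alpha> k = laguerre (\<alpha> + 1) k - laguerre (\<alpha> + 1) (k - 1)"
proof (rule poly_eqI)
  fix i
  consider "int i > k" | "int i = k" | "int i < k" by linarith
  then have "laguerre_coeff \<alpha> k i = laguerre_coeff (\<alpha> + 1) k i - laguerre_coeff (\<alpha> + 1) (k - 1) i"
  proof cases
    case 3
    then obtain n where k: "k = int (i + Suc n)"
      by (metis zless_iff_Suc_zadd int_plus add.commute of_nat_add)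
    have n: "nat k - i = Suc n" "nat (k - 1) - i = n" using k by auto
    have a: "\<alpha> + 1 + real i + 1 = (\<alpha> + real i + 1) + 1" by simp
    have "(-1) ^ i / fact i * (pochhammer (\<alpha> + real i + 1) (Suc n) / fact (Suc n)) =
      (-1) ^ i / fact i * (pochhammer (\<alpha> + real i + 1 + 1) (Suc n) / fact (Suc n) -
        pochhammer (\<alpha> + real i + 1 + 1) n / fact n)"
      by (subst pochhammer_contiguous) (rule refl)
    then show ?thesis
      using 3 unfolding laguerre_coeff_def n a
      by (simp add: right_diff_distrib mult.commute del: fact_Suc)
  qed (auto simp: laguerre_coeff_def)
  then show "coeff (laguerre \<alpha> k) i = coeff (laguerre (\<alpha> + 1) k - laguerre (\<alpha> + 1) (k - 1)) i"
    by (simp add: coeff_laguerre)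
qed

lemma pderiv_laguerre: "pderiv (laguerre \<alpha> k) = - laguerre (\<alpha> + 1) (k - 1)"
proof (rule poly_eqI)
  fix i
  have "nat k - Suc i = nat (k - 1) - i" by linarith
  moreover have "real (Suc i) * (c / (d * fact (Suc i))) = c / (d * fact i)" for c d :: real
    by simp
  moreover have "\<alpha> + real (Suc i) + 1 = \<alpha> + 1 + real i + 1"
    by simp
  ultimately have "real (Suc i) * laguerre_coeff \<alpha> k (Suc i) = - laguerre_coeff (\<alpha> + 1) (k - 1) i"
    unfolding laguerre_coeff_def by (simp del: fact_Suc of_nat_Suc) simp
  then show "coeff (pderiv (laguerre \<alpha> k)) i = coeff (- laguerre (\<alpha> + 1) (k - 1)) i"
    by (simp only: coeff_pderiv coeff_laguerre coeff_minus)
qed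

text \<open>Since \<open>L\<^sup>\<alpha>\<^sub>k\<close> is the difference of the two polynomials with parameter \<open>\<alpha> + 1\<close>, the term
  \<open>- p / 2\<close> of the operator and the derivative, which is minus the second polynomial, combine to half
  their negative sum.\<close>
lemma laguerre_deriv_laguerre:
  "laguerre_deriv (laguerre \<alpha> k) =
   smult (- 1 / 2) (laguerre (\<alpha> + 1) k + laguerre (\<alpha> + 1) (k - 1))"
  unfolding laguerre_deriv_def pderiv_laguerre
  by (subst laguerre_contiguous, rule poly_eqI) (simp add: algebra_simps)

text \<open>For parameter \<open>- p\<close> the Pochhammer symbols of all coefficients below degree \<open>p\<close> have a factor
  \<open>0\<close>; the others are quotients of factorials. This is where the threshold \<open>k \<ge> \<chi>(\<alpha>)\<close> comes from.\<close>
lemma laguerre_reflection: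
  assumes "p \<le> k"
  shows "laguerre (- real p) (int k) =
    smult ((-1) ^ p * fact (k - p) / fact k) (monom 1 p * laguerre (real p) (int k - int p))"
proof (rule poly_eqI)
  fix i
  show "coeff (laguerre (- real p) (int k)) i = coeff (smult ((-1) ^ p * fact (k - p) / fact k)
    (monom 1 p * laguerre (real p) (int k - int p))) i"
  proof (cases "i < p")
    case True
    have "pochhammer (- real p + real i + 1) (k - i) = 0"
      unfolding pochhammer_eq_0_iff
      \<comment> \<open>The base is \<open>- (p - i - 1)\<close>, and \<open>p - i - 1 < k - i\<close>.\<close>
      using True assms by (intro exI[of _ "p - i - 1"]) (auto simp: of_nat_diff)
    with True show ?thesis
      by (simp add: coeff_laguerre coeff_monom_mult laguerre_coeff_def)
  next
    case False
    then obtain j where i: "i = p + j" using le_Suc_ex not_less by blast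
    have fact_quot: "pochhammer (real r + 1) n = fact (r + n) / fact r" for r n
      using pochhammer_product'[of "1::real" r n]
      by (simp add: pochhammer_fact[symmetric] add.commute)
    show ?thesis
    proof (cases "i \<le> k")
      case le: True
      have "pochhammer (- real p + real i + 1) (k - i) = fact (k - p) / fact j"
        using fact_quot[of j "k - i"] le by (simp add: i)
      moreover have "pochhammer (real p + real j + 1) (k - i) = fact k / fact i"
        using fact_quot[of i "k - i"] le by (simp add: i)
      moreover have "nat (int k - int p) - j = k - i" "k - p - j = k - i" using i by auto
      ultimately show ?thesis
        using le i by (simp add: coeff_laguerre coeff_monom_mult laguerre_coeff_def power_add mult_ac)
    next
      case gt: False
      then show ?thesis
        using i by (simp add: coeff_laguerre coeff_monom_mult laguerre_coeff_def)
    qed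
  qed
qed

section \<open>Orthogonality\<close>

text \<open>Pascal's rule for a weighted binomial sum. It yields both the recursion of the finite
  differences and the recursion of the Sobolev forms.\<close>
lemma binomial_sum_Suc:
  fixes c :: real
  shows "(\<Sum>i\<le>Suc n. real (Suc n choose i) * c ^ (Suc n - i) * f i) =
    c * (\<Sum>i\<le>n. real (n choose i) * c ^ (n - i) * f i) +
    (\<Sum>i\<le>n. real (n choose i) * c ^ (n - i) * f (Suc i))"
proof -
  have "(\<Sum>i\<le>Suc n. real (Suc n choose i) * c ^ (Suc n - i) * f i) =
      c ^ Suc n * f 0 + (\<Sum>i\<le>n. real (n choose Suc i) * c ^ (n - i) * f (Suc i)) +
      (\<Sum>i\<le>n. real (n choose i) * c ^ (n - i) * f (Suc i))"
    by (subst sum.atMost_Suc_shift) (simp add: sum.distrib algebra_simps)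
  also have "c ^ Suc n * f 0 + (\<Sum>i\<le>n. real (n choose Suc i) * c ^ (n - i) * f (Suc i)) =
      (\<Sum>i\<le>Suc n. real (n choose i) * c ^ (Suc n - i) * f i)"
    by (subst sum.atMost_Suc_shift) simp
  also have "\<dots> = (\<Sum>i\<le>n. real (n choose i) * c ^ (Suc n - i) * f i)"
    by simp
  also have "\<dots> = c * (\<Sum>i\<le>n. real (n choose i) * c ^ (n - i) * f i)"
    unfolding sum_distrib_left by (intro sum.cong) (simp_all add: Suc_diff_le)
  finally show ?thesis .
qed

text \<open>The \<open>k\<close>-th forward difference of the rising factorial \<open>x \<mapsto> (x)\<^sub>m\<close>. One difference sends
  \<open>(x)\<^sub>m\<close> to \<open>m (x + 1)\<^sub>m\<^sub>-\<^sub>1\<close>, so nothing is left after more than \<open>m\<close> of them.\<close>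
lemma pochhammer_alternating_sum:
  fixes a :: real
  assumes "m \<le> k"
  shows "(\<Sum>i\<le>k. (-1) ^ (k - i) * real (k choose i) * pochhammer (a + real i) m) =
    (if m = k then fact k else 0)"
  using assms
proof (induction k arbitrary: a m)
  case 0
  then show ?case by simp
next
  case (Suc k)
  \<comment> \<open>The sum written with the factors in the order of \<open>binomial_sum_Suc\<close>, for \<open>c = -1\<close>.\<close>
  let ?S = "\<lambda>k f. \<Sum>i\<le>k. real (k choose i) * (-1::real) ^ (k - i) * f i"
  have "?S (Suc k) (\<lambda>i. pochhammer (a + real i) m) =
      ?S k (\<lambda>i. pochhammer (a + real (Suc i)) m - pochhammer (a + real i) m)"
    unfolding binomial_sum_Suc by (simp add: sum_subtractf[symmetric] algebra_simps)
  also have "\<dots> = (if m = Suc k then fact (Suc k) else 0)"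
  proof (cases m)
    case 0
    then show ?thesis by simp
  next
    case m: (Suc l)
    have "pochhammer (b + 1) (Suc l) - pochhammer b (Suc l) =
        (real l + 1) * pochhammer (b + 1) l" for b :: real
      unfolding pochhammer_rec[of b] pochhammer_rec'[of "b + 1"] by (simp add: algebra_simps)
    from this[of "a + real i" for i]
    have "?S k (\<lambda>i. pochhammer (a + real (Suc i)) m - pochhammer (a + real i) m) =
        (real l + 1) * ?S k (\<lambda>i. pochhammer (a + 1 + real i) l)"
      unfolding m sum_distrib_left by (intro sum.cong) (simp_all add: algebra_simps)
    also have "?S k (\<lambda>i. pochhammer (a + 1 + real i) l) = (if l = k then fact k else 0)"
      using Suc.IH[of l "a + 1"] Suc.prems m by (simp add: mult_ac)
    finally show ?thesis using m by simp
  qed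
  finally show ?case by (simp add: mult_ac)
qed

text \<open>In the \<open>i\<close>-th term, \<open>\<Gamma>(\<alpha> + i + m + 1) = (\<alpha> + i + 1)\<^sub>m \<Gamma>(\<alpha> + i + 1)\<close>, and the factor
  \<open>\<Gamma>(\<alpha> + i + 1)\<close> is absorbed by the Pochhammer symbol of the coefficient into \<open>\<Gamma>(\<alpha> + k + 1)\<close>,
  independent of \<open>i\<close>. What remains is the alternating sum of \<open>(\<alpha> + 1 + i)\<^sub>m\<close>.\<close>
lemma laguerre_functional_laguerre_monom:
  assumes "\<alpha> > -1" "m \<le> k"
  shows "laguerre_functional \<alpha> (laguerre \<alpha> (int k) * monom c m) =
    (if m = k then c * (-1) ^ k * Gamma (\<alpha> + real k + 1) else 0)"
proof -
  let ?G = "Gamma (\<alpha> + real k + 1)"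
  have summand: "laguerre_coeff \<alpha> (int k) i * c * Gamma (\<alpha> + real (i + m) + 1) =
      c * ?G * (-1) ^ k / fact k *
        ((-1) ^ (k - i) * real (k choose i) * pochhammer (\<alpha> + 1 + real i) m)" if "i \<le> k" for i
  proof -
    have "\<alpha> + real i + 1 \<notin> \<int>\<^sub>\<le>\<^sub>0"
      using assms(1) by (auto elim!: nonpos_Ints_cases)
    then have poch: "pochhammer (\<alpha> + real i + 1) n * Gamma (\<alpha> + real i + 1) =
        Gamma (\<alpha> + real i + 1 + real n)" for n
      using pochhammer_Gamma[of "\<alpha> + real i + 1" n] Gamma_eq_zero_iff[of "\<alpha> + real i + 1"]
      by simp
    have 1: "pochhammer (\<alpha> + real i + 1) (k - i) * Gamma (\<alpha> + real i + 1) = ?G"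
      using poch[of "k - i"] that by (simp add: of_nat_diff add_ac)
    have 2: "Gamma (\<alpha> + real (i + m) + 1) =
        pochhammer (\<alpha> + 1 + real i) m * Gamma (\<alpha> + real i + 1)"
      using poch[of m] by (simp add: add_ac)
    have 3: "(-1::real) ^ k * (-1) ^ (k - i) = (-1) ^ i"
    proof -
      have "(-1::real) ^ k = (-1) ^ i * (-1) ^ (k - i)"
        using that by (simp flip: power_add)
      moreover have "(-1::real) ^ (k - i) * (-1) ^ (k - i) = 1"
        by (simp flip: power_mult_distrib)
      ultimately show ?thesis by simp
    qed
    have 4: "real (k choose i) = fact k / (fact i * fact (k - i))"
      using that by (rule binomial_fact)
    have "laguerre_coeff \<alpha> (int k) i * c * Gamma (\<alpha> + real (i + m) + 1) =
        c * ((-1) ^ i / (fact (k - i) * fact i)) * pochhammer (\<alpha> + 1 + real i) m *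
        (pochhammer (\<alpha> + real i + 1) (k - i) * Gamma (\<alpha> + real i + 1))"
      using that unfolding 2 by (simp add: laguerre_coeff_def)
    then show ?thesis unfolding 1 4 3[symmetric] by (simp add: mult_ac)
  qed
  have "laguerre_functional \<alpha> (laguerre \<alpha> (int k) * monom c m) =
      (\<Sum>i\<le>k. laguerre_coeff \<alpha> (int k) i * c * Gamma (\<alpha> + real (i + m) + 1))"
    using assms(1) unfolding laguerre_def sum_distrib_right mult_monom
    by (subst laguerre_functional_sum)
      (simp_all add: laguerre_integrable_monom laguerre_functional_monom)
  also have "\<dots> = c * ?G * (-1) ^ k / fact k *
      (\<Sum>i\<le>k. (-1) ^ (k - i) * real (k choose i) * pochhammer (\<alpha> + 1 + real i) m)"
    unfolding sum_distrib_left by (intro sum.cong refl summand) simp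
  also have "\<dots> = (if m = k then c * (-1) ^ k * ?G else 0)"
    unfolding pochhammer_alternating_sum[OF assms(2)] by simp
  finally show ?thesis .
qed

text \<open>By symmetry let \<open>m \<le> k\<close>. Only the leading term of the polynomial of index \<open>m\<close>, with coefficient
  \<open>(-1)\<^sup>m / m!\<close>, can contribute, and only if \<open>m = k\<close>.\<close>
lemma laguerre_orthogonal_classical:
  assumes "\<alpha> > -1"
  shows "laguerre_functional \<alpha> (laguerre \<alpha> (int k) * laguerre \<alpha> (int m)) =
    (if k = m then laguerre_gamma \<alpha> k else 0)"
proof -
  have le: "laguerre_functional \<alpha> (laguerre \<alpha> (int k) * laguerre \<alpha> (int m)) =
      (if k = m then laguerre_gamma \<alpha> k else 0)" if "m \<le> k" for k m
  proof -
    have "laguerre_functional \<alpha> (laguerre \<alpha> (int k) * laguerre \<alpha> (int m)) =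
        (\<Sum>j\<le>m. laguerre_functional \<alpha>
          (laguerre \<alpha> (int k) * monom (laguerre_coeff \<alpha> (int m) j) j))"
      unfolding laguerre_def[of \<alpha> "int m"] sum_distrib_left nat_int
      by (intro laguerre_functional_sum laguerre_integrable_poly assms finite_atMost)
    also have "\<dots> = (\<Sum>j\<le>m. if j = k then
        laguerre_coeff \<alpha> (int m) j * (-1) ^ k * Gamma (\<alpha> + real k + 1) else 0)"
      using that assms by (intro sum.cong refl) (simp add: laguerre_functional_laguerre_monom)
    also have "\<dots> = (if k = m then laguerre_gamma \<alpha> k else 0)"
      using that by (auto simp: laguerre_coeff_def laguerre_gamma_def add_ac)
    finally show ?thesis .
  qed
  show ?thesis
    using le[of m k] le[of k m] by (cases "m \<le> k") (auto simp: mult.commute)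
qed

text \<open>The condition \<open>k \<ge> \<chi>(\<gamma>)\<close> for \<open>\<gamma> > -1\<close> or \<open>\<gamma>\<close> a negative integer, relaxed in the first case to
  all integers \<open>k\<close>: negative indices give the zero polynomial, and lowering \<open>k\<close> by one must stay
  possible in the induction.\<close>
definition laguerre_index :: "real \<Rightarrow> int \<Rightarrow> bool" where
  "laguerre_index \<gamma> k \<longleftrightarrow> \<gamma> > -1 \<or> (\<exists>m>0. \<gamma> = - real m \<and> int m \<le> k)"

lemma laguerre_index_mono: "laguerre_index \<gamma> k \<Longrightarrow> k \<le> l \<Longrightarrow> laguerre_index \<gamma> l"
  unfolding laguerre_index_def by force

lemma laguerre_index_cases:
  assumes "laguerre_index \<gamma> k"
  obtains "\<gamma> > -1"
  | p i where "p > 0" "\<gamma> = - real p" "k = int i" "p \<le> i"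
proof (cases "\<gamma> > -1")
  case False
  then obtain p where "p > 0" "\<gamma> = - real p" "int p \<le> k"
    using assms by (auto simp: laguerre_index_def)
  then show ?thesis using that(2)[of p "nat k"] by simp
qed (use that in blast)

lemma laguerre_orthogonal:
  assumes "laguerre_index \<alpha> k" "laguerre_index \<alpha> m"
  shows "laguerre_functional \<alpha> (laguerre \<alpha> k * laguerre \<alpha> m) =
    (if k = m then laguerre_gamma_rec 0 \<alpha> k else 0)"
  using assms(1)
proof (cases rule: laguerre_index_cases)
  case 1
  show ?thesis
  proof (cases "k < 0 \<or> m < 0")
    case True
    then show ?thesis by auto
  next
    case False
    then show ?thesis
      using laguerre_orthogonal_classical[OF 1, of "nat k" "nat m"] by (simp add: eq_nat_nat_iff)
  qed
next
  case (2 p i)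
  \<comment> \<open>The norm with parameter \<open>p\<close> is \<open>i! / (i - p)!\<close>. The square of the reflection factor
    inverts it to \<open>(i - p)! / i!\<close>, which is the norm asserted for parameter \<open>- p\<close>.\<close>
  from assms(2) obtain j where j: "m = int j" "p \<le> j"
    by (cases rule: laguerre_index_cases) (use 2 in auto)
  let ?c = "\<lambda>i. (-1) ^ p * fact (i - p) / fact i :: real"
  have pow: "(-1::real) ^ p * (-1) ^ p = 1"
    by (simp flip: power_mult_distrib)
  have "laguerre_functional \<alpha> (laguerre \<alpha> k * laguerre \<alpha> m) =
      laguerre_functional (- real p)
        (smult (?c i * ?c j) (monom 1 p * laguerre (real p) (int (i - p)) *
          (monom 1 p * laguerre (real p) (int (j - p)))))"
    using 2 j by (simp add: laguerre_reflection of_nat_diff mult_ac)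
  also have "\<dots> = ?c i * ?c j *
      (if i - p = j - p then laguerre_gamma (real p) (i - p) else 0)"
    by (simp only: laguerre_functional_smult laguerre_functional_monom_mult
        laguerre_orthogonal_classical[of "real p"])
  also have "\<dots> = (if k = m then laguerre_gamma_rec 0 \<alpha> k else 0)"
  proof (cases "i = j")
    case True
    have "laguerre_gamma (real p) (i - p) = fact i / fact (i - p)"
      using 2 Gamma_fact[of i, where ?'a = real]
      by (simp add: laguerre_gamma_def of_nat_diff add_ac)
    moreover have "laguerre_gamma (- real p) i = fact (i - p) / fact i"
      using 2 Gamma_fact[of "i - p", where ?'a = real]
      by (simp add: laguerre_gamma_def of_nat_diff algebra_simps)
    ultimately show ?thesis using True 2 j pow by (simp add: field_simps)
  next
    case False
    then show ?thesis using 2 j by auto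
  qed
  finally show ?thesis .
qed

lemma tame_laguerre:
  assumes "laguerre_index \<alpha> k"
  shows "tame \<alpha> (laguerre \<alpha> k)"
  using assms
  by (cases rule: laguerre_index_cases)
    (auto simp: tame_def laguerre_reflection dvd_smult)

text \<open>In the case of negative integers, \<open>L\<^sup>\<alpha>\<^sub>k\<close> vanishes at \<open>0\<close> to order \<open>- \<alpha>\<close>, and each
  differentiation costs one order; after at most \<open>n\<close> of them the order is still \<open>- (\<alpha> + n)\<close>. The proof expresses everything through
  Laguerre polynomials with parameter \<open>\<alpha> + 1\<close>, keeping the weight exponent fixed.\<close>
lemma tame_laguerre_deriv_laguerre:
  assumes "laguerre_index (\<alpha> + real n) (k - int n)" "i \<le> n"
  shows "tame (\<alpha> + real n) ((laguerre_deriv ^^ i) (laguerre \<alpha> k))"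
  using assms
proof (induction n arbitrary: \<alpha> k i)
  case 0
  then show ?case by (simp add: tame_laguerre)
next
  case (Suc n)
  have shift: "\<alpha> + 1 + real n = \<alpha> + real (Suc n)" by simp
  have tame: "tame (\<alpha> + real (Suc n)) ((laguerre_deriv ^^ j) (laguerre (\<alpha> + 1) l))"
    if "j \<le> n" "l \<in> {k, k - 1}" for j l
    using Suc.IH[of "\<alpha> + 1" l j] that laguerre_index_mono[OF Suc.prems(1), of "l - int n"]
    unfolding shift by auto
  show ?case
  proof (cases i)
    case 0
    have "tame (\<alpha> + real (Suc n)) (laguerre (\<alpha> + 1) k - laguerre (\<alpha> + 1) (k - 1))"
      using tame[of 0] by (intro tame_diff) auto
    then show ?thesis using 0 by (simp flip: laguerre_contiguous)
  next
    case (Suc j)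
    then have "(laguerre_deriv ^^ i) (laguerre \<alpha> k) =
        smult (- 1 / 2) ((laguerre_deriv ^^ j) (laguerre (\<alpha> + 1) k) +
          (laguerre_deriv ^^ j) (laguerre (\<alpha> + 1) (k - 1)))"
      by (simp only: funpow_Suc_right o_apply laguerre_deriv_laguerre laguerre_deriv_pow_linear)
    then show ?thesis
      using tame[of j] Suc Suc.prems by (auto simp del: smult_minus_left intro!: tame_smult tame_add)
  qed
qed

text \<open>The form \<open>laguerre_form\<close> at \<open>\<beta> = 1\<close>, on the polynomial factors. The parameter \<open>\<gamma>\<close> is the weight
  exponent \<open>\<alpha> + n\<close>, which stays constant along the recursion on \<open>n\<close>.\<close>
definition sobolev_form :: "real \<Rightarrow> nat \<Rightarrow> real poly \<Rightarrow> real poly \<Rightarrow> real" where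
  "sobolev_form \<gamma> n p q = (\<Sum>i\<le>n. real (n choose i) * (1 / 4) ^ (n - i) *
     laguerre_functional \<gamma> ((laguerre_deriv ^^ i) p * (laguerre_deriv ^^ i) q))"

text \<open>All summands are homogeneous in \<open>\<beta>\<close> of the same degree: \<open>2 n - 2 i\<close> from the coefficient,
  \<open>2 i\<close> from the derivatives and \<open>- \<alpha> - n - 1\<close> from the change of variables.\<close>
lemma laguerre_form_exp_poly:
  assumes "\<beta> > 0"
  shows "laguerre_form \<alpha> \<beta> n (exp_poly \<beta> p) (exp_poly \<beta> q) =
    \<beta> powr (real n - \<alpha> - 1) * sobolev_form (\<alpha> + real n) n p q"
proof -
  have "real (n choose i) * (\<beta> ^ (2 * n - 2 * i) / 2 ^ (2 * n - 2 * i)) *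
      weighted_inner (\<alpha> + real n) ((deriv ^^ i) (exp_poly \<beta> p)) ((deriv ^^ i) (exp_poly \<beta> q)) =
      \<beta> powr (real n - \<alpha> - 1) * (real (n choose i) * (1 / 4) ^ (n - i) *
        laguerre_functional (\<alpha> + real n) ((laguerre_deriv ^^ i) p * (laguerre_deriv ^^ i) q))"
    if "i \<le> n" for i
  proof -
    have "2 * n - 2 * i = 2 * (n - i)" by simp
    then have 4: "(1::real) / 2 ^ (2 * n - 2 * i) = (1 / 4) ^ (n - i)"
      by (simp add: power_mult power_one_over)
    have "\<beta> ^ (2 * n - 2 * i) * (\<beta> ^ i * \<beta> ^ i) = \<beta> ^ (2 * n)"
      using that by (simp flip: power_add mult_2)
    then have pow: "\<beta> ^ (2 * n - 2 * i) * (\<beta> ^ i * \<beta> ^ i) * \<beta> powr (- (\<alpha> + real n) - 1) =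
        \<beta> powr (real n - \<alpha> - 1)"
      using assms by (simp flip: powr_realpow powr_add) (simp add: algebra_simps)
    have "real (n choose i) * (\<beta> ^ (2 * n - 2 * i) / 2 ^ (2 * n - 2 * i)) *
      weighted_inner (\<alpha> + real n) ((deriv ^^ i) (exp_poly \<beta> p)) ((deriv ^^ i) (exp_poly \<beta> q)) =
      (\<beta> ^ (2 * n - 2 * i) * (\<beta> ^ i * \<beta> ^ i) * \<beta> powr (- (\<alpha> + real n) - 1)) *
      (real (n choose i) * (1 / 2 ^ (2 * n - 2 * i)) *
        laguerre_functional (\<alpha> + real n) ((laguerre_deriv ^^ i) p * (laguerre_deriv ^^ i) q))"
      using assms
      by (simp add: deriv_pow_exp_poly weighted_inner_exp_poly laguerre_functional_smult)
    then show ?thesis unfolding pow 4 .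
  qed
  then show ?thesis
    unfolding laguerre_form_def sobolev_form_def sum_distrib_left by (intro sum.cong) auto
qed

lemma sobolev_form_Suc:
  "sobolev_form \<gamma> (Suc n) p q =
   1 / 4 * sobolev_form \<gamma> n p q + sobolev_form \<gamma> n (laguerre_deriv p) (laguerre_deriv q)"
  unfolding sobolev_form_def binomial_sum_Suc by (simp add: funpow_swap1)

text \<open>The mixed terms cancel; tameness makes every term of the expansion integrable.\<close>
lemma laguerre_functional_parallelogram:
  assumes "tame \<gamma> p" "tame \<gamma> p'" "tame \<gamma> q" "tame \<gamma> q'"
  shows "laguerre_functional \<gamma> ((p - p') * (q - q')) + laguerre_functional \<gamma> ((p + p') * (q + q')) =
    2 * (laguerre_functional \<gamma> (p * q) + laguerre_functional \<gamma> (p' * q'))"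
proof -
  have "laguerre_functional \<gamma> ((p - p') * (q - q')) + laguerre_functional \<gamma> ((p + p') * (q + q')) =
      laguerre_functional \<gamma> ((p - p') * (q - q') + (p + p') * (q + q'))"
    using assms
    by (intro laguerre_functional_add[symmetric] tame_mult_integrable tame_diff tame_add)
  also have "(p - p') * (q - q') + (p + p') * (q + q') = smult 2 (p * q + p' * q')"
    using smult_add_left[of 1 1 "p * q + p' * q'"] by (simp add: algebra_simps)
  also have "laguerre_functional \<gamma> \<dots> =
      2 * (laguerre_functional \<gamma> (p * q) + laguerre_functional \<gamma> (p' * q'))"
    using assms by (simp add: laguerre_functional_smult laguerre_functional_add tame_mult_integrable)
  finally show ?thesis .
qed

text \<open>The recurrence of the \<open>\<gamma>\<close> numbers is the parallelogram identity: one summand of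
  \<open>sobolev_form_Suc\<close> sees \<open>L\<^sup>\<alpha>\<^sub>k\<close> as a difference of polynomials with parameter \<open>\<alpha> + 1\<close>, the other sees
  its derivative as the corresponding sum, both with factor \<open>1 / 4\<close>. The Kronecker symbol survives
  because \<open>k = m\<close> and \<open>k - 1 = m - 1\<close> are equivalent.\<close>
lemma sobolev_form_laguerre:
  assumes "laguerre_index (\<alpha> + real n) (k - int n)" "laguerre_index (\<alpha> + real n) (m - int n)"
  shows "sobolev_form (\<alpha> + real n) n (laguerre \<alpha> k) (laguerre \<alpha> m) =
    (if k = m then laguerre_gamma_rec n \<alpha> k else 0)"
  using assms
proof (induction n arbitrary: \<alpha> k m)
  case 0
  then show ?case by (simp add: sobolev_form_def laguerre_orthogonal del: laguerre_gamma_rec.simps)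
next
  case (Suc n)
  let ?\<gamma> = "\<alpha> + real (Suc n)"
  let ?L = "\<lambda>k. laguerre (\<alpha> + 1) k"
  have shift: "\<alpha> + 1 + real n = ?\<gamma>" by simp
  have index: "laguerre_index ?\<gamma> (l - int n)" if "l \<in> {k, k - 1, m, m - 1}" for l
    using that laguerre_index_mono[OF Suc.prems(1), of "l - int n"]
      laguerre_index_mono[OF Suc.prems(2), of "l - int n"] by auto
  have tame: "tame ?\<gamma> ((laguerre_deriv ^^ i) (?L l))" if "i \<le> n" "l \<in> {k, k - 1, m, m - 1}" for i l
    using tame_laguerre_deriv_laguerre[of "\<alpha> + 1" n l i] that index[of l] unfolding shift by auto
  have parallelogram:
    "1 / 4 * sobolev_form ?\<gamma> n (?L k - ?L (k - 1)) (?L m - ?L (m - 1)) +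
       1 / 4 * sobolev_form ?\<gamma> n (?L k + ?L (k - 1)) (?L m + ?L (m - 1)) =
     1 / 2 * (sobolev_form ?\<gamma> n (?L k) (?L m) + sobolev_form ?\<gamma> n (?L (k - 1)) (?L (m - 1)))"
    unfolding sobolev_form_def sum_distrib_left sum.distrib[symmetric]
  proof (intro sum.cong refl)
    fix i assume "i \<in> {..n}"
    let ?D = "\<lambda>p. (laguerre_deriv ^^ i) p" and ?K = "laguerre_functional ?\<gamma>"
    let ?w = "real (n choose i) * (1 / 4) ^ (n - i)"
    have "?K (?D (?L k - ?L (k - 1)) * ?D (?L m - ?L (m - 1))) +
        ?K (?D (?L k + ?L (k - 1)) * ?D (?L m + ?L (m - 1))) =
        2 * (?K (?D (?L k) * ?D (?L m)) + ?K (?D (?L (k - 1)) * ?D (?L (m - 1))))"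
      unfolding laguerre_deriv_pow_linear
      using \<open>i \<in> {..n}\<close> by (intro laguerre_functional_parallelogram tame) auto
    then have "?w / 4 * (?K (?D (?L k - ?L (k - 1)) * ?D (?L m - ?L (m - 1))) +
        ?K (?D (?L k + ?L (k - 1)) * ?D (?L m + ?L (m - 1)))) =
        ?w / 4 * (2 * (?K (?D (?L k) * ?D (?L m)) + ?K (?D (?L (k - 1)) * ?D (?L (m - 1)))))"
      by simp
    then show "1 / 4 * (?w * ?K (?D (?L k - ?L (k - 1)) * ?D (?L m - ?L (m - 1)))) +
        1 / 4 * (?w * ?K (?D (?L k + ?L (k - 1)) * ?D (?L m + ?L (m - 1)))) =
      1 / 2 * (?w * ?K (?D (?L k) * ?D (?L m)) + ?w * ?K (?D (?L (k - 1)) * ?D (?L (m - 1))))"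
      by (simp only: distrib_left) (simp add: algebra_simps)
  qed
  have "sobolev_form ?\<gamma> n (laguerre_deriv (laguerre \<alpha> k)) (laguerre_deriv (laguerre \<alpha> m)) =
      1 / 4 * sobolev_form ?\<gamma> n (?L k + ?L (k - 1)) (?L m + ?L (m - 1))"
    unfolding laguerre_deriv_laguerre sobolev_form_def laguerre_deriv_pow_linear(3) sum_distrib_left
    by (intro sum.cong) (simp_all add: laguerre_functional_smult)
  moreover have "sobolev_form ?\<gamma> n (laguerre \<alpha> k) (laguerre \<alpha> m) =
      sobolev_form ?\<gamma> n (?L k - ?L (k - 1)) (?L m - ?L (m - 1))"
    by (simp flip: laguerre_contiguous)
  ultimately have "sobolev_form ?\<gamma> (Suc n) (laguerre \<alpha> k) (laguerre \<alpha> m) =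
      1 / 2 * (sobolev_form ?\<gamma> n (?L k) (?L m) + sobolev_form ?\<gamma> n (?L (k - 1)) (?L (m - 1)))"
    unfolding sobolev_form_Suc using parallelogram by simp
  also have "\<dots> = (if k = m then laguerre_gamma_rec (Suc n) \<alpha> k else 0)"
    using Suc.IH[of "\<alpha> + 1" k m] Suc.IH[of "\<alpha> + 1" "k - 1" "m - 1"]
      index[of k] index[of m] index[of "k - 1"] index[of "m - 1"]
    unfolding shift by auto
  finally show ?case .
qed

section \<open>The norms\<close>

lemma laguerre_gamma_rec_neg: "k < 0 \<Longrightarrow> laguerre_gamma_rec n \<alpha> k = 0"
  by (induction n arbitrary: \<alpha> k) auto

text \<open>The value of index \<open>k - 1\<close> may vanish (at \<open>k = 0\<close>); the one of index \<open>k\<close> is positive.\<close>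
lemma laguerre_gamma_rec_pos:
  assumes "laguerre_index (\<alpha> + real n) (k - int n)" "k \<ge> 0"
  shows "laguerre_gamma_rec n \<alpha> k > 0"
  using assms
proof (induction n arbitrary: \<alpha> k)
  case 0
  then have "laguerre_index \<alpha> k" by simp
  then have "real (nat k) + \<alpha> + 1 > 0"
    by (cases rule: laguerre_index_cases) auto
  with 0 show ?case by (simp add: laguerre_gamma_def Gamma_real_pos)
next
  case (Suc n)
  have index: "laguerre_index (\<alpha> + 1 + real n) (l - int n)" if "l \<in> {k, k - 1}" for l
    using that laguerre_index_mono[OF Suc.prems(1), of "l - int n"] by (auto simp: add_ac)
  have "laguerre_gamma_rec n (\<alpha> + 1) (k - 1) \<ge> 0"
    using Suc.IH[of "\<alpha> + 1" "k - 1"] index[of "k - 1"] laguerre_gamma_rec_neg[of "k - 1" n]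
    by (cases "k - 1 < 0") force+
  moreover have "laguerre_gamma_rec n (\<alpha> + 1) k > 0"
    using Suc.IH[of "\<alpha> + 1" k] index[of k] Suc.prems by auto
  ultimately show ?case by simp
qed

text \<open>\<open>\<chi>\<^sub>n(\<alpha>) = - \<alpha>\<close> exceeds the threshold \<open>- (\<alpha> + n)\<close> of the weight exponent by \<open>n\<close>, hence the
  shift of the index.\<close>
lemma laguerre_index_chi:
  assumes "\<alpha> + real n \<in> aleph" "real k \<ge> chi n \<alpha>"
  shows "laguerre_index (\<alpha> + real n) (int k - int n)"
proof (cases "\<alpha> + real n \<in> neg_integers")
  case True
  then obtain z :: int where z: "z < 0" "\<alpha> + real n = of_int z"
    by (auto simp: neg_integers_def)
  have "real_of_int (int k) \<ge> of_int (int n - z)"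
    using assms(2) True z by (simp add: chi_def)
  then have "int k \<ge> int n - z" by (simp only: of_int_le_iff)
  then show ?thesis
    using z by (auto simp: laguerre_index_def intro!: disjI2 exI[of _ "nat (- z)"])
next
  case False
  with assms(1) show ?thesis by (auto simp: aleph_def laguerre_index_def)
qed

theorem theorem1:
  fixes \<beta> :: real
  assumes "\<beta> > 0"
  shows
    "(\<forall>\<alpha>\<in>aleph. \<forall>k m. real k \<ge> chi 0 \<alpha> \<longrightarrow> real m \<ge> chi 0 \<alpha> \<longrightarrow>
        weighted_integrable \<alpha> (laguerre_fun \<alpha> \<beta> k) (laguerre_fun \<alpha> \<beta> m) \<and>
        laguerre_form \<alpha> \<beta> 0 (laguerre_fun \<alpha> \<beta> k) (laguerre_fun \<alpha> \<beta> m)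
          = weighted_inner \<alpha> (laguerre_fun \<alpha> \<beta> k) (laguerre_fun \<alpha> \<beta> m) \<and>
        weighted_inner \<alpha> (laguerre_fun \<alpha> \<beta> k) (laguerre_fun \<alpha> \<beta> m)
          = \<beta> powr (- \<alpha> - 1) * laguerre_gamma \<alpha> k * kronecker k m)
     \<and>
     (\<forall>n \<alpha>. \<alpha> + real n \<in> aleph \<longrightarrow>
        (\<forall>k m. real k \<ge> chi n \<alpha> \<longrightarrow> real m \<ge> chi n \<alpha> \<longrightarrow>
           (\<forall>\<nu>\<le>n. weighted_integrable (\<alpha> + real n)
              ((deriv ^^ \<nu>) (laguerre_fun \<alpha> \<beta> k)) ((deriv ^^ \<nu>) (laguerre_fun \<alpha> \<beta> m))) \<and>
           laguerre_form \<alpha> \<beta> n (laguerre_fun \<alpha> \<beta> k) (laguerre_fun \<alpha> \<beta> m)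
             = \<beta> powr (real n - \<alpha> - 1) * laguerre_gamma_rec n \<alpha> (int k) * kronecker k m) \<and>
        (\<forall>k. real k \<ge> chi n \<alpha> \<longrightarrow> laguerre_gamma_rec n \<alpha> (int k) > 0) \<and>
        (\<forall>k. real k \<ge> chi 0 (\<alpha> + real n) \<longrightarrow>
           laguerre_gamma_rec 0 (\<alpha> + real n) (int k) = laguerre_gamma (\<alpha> + real n) k) \<and>
        (n \<ge> 1 \<longrightarrow> (\<forall>k. real k \<ge> chi n \<alpha> \<longrightarrow>
           laguerre_gamma_rec n \<alpha> (int k)
             = 1 / 2 * (laguerre_gamma_rec (n - 1) (\<alpha> + 1) (int k)
                        + laguerre_gamma_rec (n - 1) (\<alpha> + 1) (int k - 1)))) \<and>
        (\<forall>j<0. laguerre_gamma_rec n \<alpha> j = 0))"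
proof -
  have integrable: "weighted_integrable (\<alpha> + real n)
      ((deriv ^^ i) (laguerre_fun \<alpha> \<beta> k)) ((deriv ^^ i) (laguerre_fun \<alpha> \<beta> m))"
    if "\<alpha> + real n \<in> aleph" "real k \<ge> chi n \<alpha>" "real m \<ge> chi n \<alpha>" "i \<le> n" for \<alpha> n k m i
    using assms that unfolding laguerre_fun_eq_exp_poly deriv_pow_exp_poly
    by (simp add: weighted_integrable_exp_poly laguerre_integrable_smult tame_mult_integrable
        tame_laguerre_deriv_laguerre laguerre_index_chi)
  have form: "laguerre_form \<alpha> \<beta> n (laguerre_fun \<alpha> \<beta> k) (laguerre_fun \<alpha> \<beta> m) =
      \<beta> powr (real n - \<alpha> - 1) * laguerre_gamma_rec n \<alpha> (int k) * kronecker k m"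
    if "\<alpha> + real n \<in> aleph" "real k \<ge> chi n \<alpha>" "real m \<ge> chi n \<alpha>" for \<alpha> n k m
    using assms that
    by (simp add: laguerre_fun_eq_exp_poly laguerre_form_exp_poly sobolev_form_laguerre
        laguerre_index_chi kronecker_def)
  have form0: "laguerre_form \<alpha> \<beta> 0 u v = weighted_inner \<alpha> u v" for \<alpha> u v
    by (simp add: laguerre_form_def)
  have rec: "laguerre_gamma_rec n \<alpha> k = 1 / 2 *
      (laguerre_gamma_rec (n - 1) (\<alpha> + 1) k + laguerre_gamma_rec (n - 1) (\<alpha> + 1) (k - 1))"
    if "n \<ge> 1" for n \<alpha> k
    using that by (cases n) auto
  have classical: "weighted_integrable \<alpha> (laguerre_fun \<alpha> \<beta> k) (laguerre_fun \<alpha> \<beta> m)"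
    "weighted_inner \<alpha> (laguerre_fun \<alpha> \<beta> k) (laguerre_fun \<alpha> \<beta> m) =
      \<beta> powr (- \<alpha> - 1) * laguerre_gamma \<alpha> k * kronecker k m"
    if "\<alpha> \<in> aleph" "real k \<ge> chi 0 \<alpha>" "real m \<ge> chi 0 \<alpha>" for \<alpha> k m
    using integrable[of \<alpha> 0 k m 0] form[of \<alpha> 0 k m] that by (simp_all add: form0)
  show ?thesis
    using form0 classical integrable form rec laguerre_gamma_rec_neg
      laguerre_gamma_rec_pos[OF laguerre_index_chi]
    by (intro conjI allI ballI impI) auto
qed

end
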